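(* Suppose $\|g(x)-g(y)\|\le\kappa\|x-y\|$ for all $x,y\in\mathbb{R}^d$ with $\kappa\le 1$, and $\|g'(x)-g'(y)\|\le\gamma\|x-y\|$ for all $x,y\in\mathbb{R}^d$ with $\gamma>0$. Let $\{x_t\}$ be generated by AAP($m$) with $S_t$ and $Y_t$ of full column rank for all $t\ge 0$. Suppose there exist constants $T>0$ and $M>0$ such that, for all $t\ge T$, $J_t$ is invertible, $\sigma_{\min}(Y_t)\ge M\|f_t\|$, and $J_tG_t$ has full column rank. If $f_t\to 0$ as $t\to\infty$, then $$\frac{1}{\|f_t\|}\widehat{p}_t\to\frac{1}{\|f_t\|}p_t^{\mathrm N},$$ meaning that the norm of the difference of the two sides tends to $0$.
   Context: $g:\mathbb{R}^d\to\mathbb{R}^d$ is continuously differentiable, with Jacobian $g'$, and $f(x):=g(x)-x$. $\|\cdot\|$ is the Euclidean norm for vectors and the induced 2-norm for matrices; $\sigma_{\min}$ is the smallest singular value. AAP($m$) (Alternating Anderson-Picard method), with integer $1\le m\le d$, damping ratios $\beta_t\ge 0$ and starting point $x_0\in\mathbb{R}^d$: for $t=0,1,2,\dots$ set $x_t^0:=x_t$, $x_t^{\ell}:=g(x_t^{\ell-1})$ for $1\le\ell\le m$, $f_t^\ell:=f(x_t^\ell)$ for $0\le\ell\le m$, and $f_t:=f_t^0=f(x_t)$. Let $\alpha_t=(\alpha_t^0,\dots,\alpha_t^m)\in\mathbb{R}^{m+1}$ minimize $\|\sum_{\ell=0}^m\alpha^\ell f_t^\ell\|^2$ subject to $\sum_{\ell=0}^m\alpha^\ell=1$,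 and set $x_{t+1}:=(1-\beta_t)\sum_{\ell=0}^m\alpha_t^\ell x_t^\ell+\beta_t\sum_{\ell=0}^m\alpha_t^\ell g(x_t^\ell)$. $S_t:=[s_t^0,\dots,s_t^{m-1}]$ and $Y_t:=[y_t^0,\dots,y_t^{m-1}]$ in $\mathbb{R}^{d\times m}$, where $s_t^\ell:=x_t^{\ell+1}-x_t^\ell$ and $y_t^\ell:=f_t^{\ell+1}-f_t^\ell$. (Full column rank of $S_t$ forces $f_t=s_t^0\neq 0$.) $J_t:=f'(x_t)$ and $G_t:=[f_t,\ g'(x_t)f_t,\ g'(x_t)^2f_t,\ \dots,\ g'(x_t)^{m-1}f_t]\in\mathbb{R}^{d\times m}$ (matrix powers). $\mathcal{K}_n(A,b):=\mathrm{span}\{b,Ab,\dots,A^{n-1}b\}$. $\mathbb{B}_t:=\{B\in\mathbb{R}^{d\times d}: B S_t=Y_t\}$. Multisecant-GMRES direction: $\widehat{p}_t:=\operatorname{arg\,min}_{p\in\mathcal{K}_m(B_t,f_t)}\|B_tp-f_t\|^2$ for any $B_t\in\mathbb{B}_t$ (independent of the choice of $B_t$; equal to $S_tY_t^\dagger f_t$). Newton-GMRES direction: $p_t^{\mathrm N}:=\operatorname{arg\,min}_{p\in\mathcal{K}_m(J_t,f_t)}\|J_tp-f_t\|$. *)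

theory Defs
  imports "HOL-Analysis.Analysis"
begin

text \<open>
  The multiplication of the ring structure on \<open>real^'n^'n\<close> is componentwise, so
  \<open>A ^ k\<close> would not be the matrix power.
\<close>

primrec mat_power :: "real^'n^'n \<Rightarrow> nat \<Rightarrow> real^'n^'n" where
  "mat_power A 0 = mat 1"
| "mat_power A (Suc k) = A ** mat_power A k"

definition krylov :: "nat \<Rightarrow> real^'n^'n \<Rightarrow> real^'n \<Rightarrow> (real^'n) set" where
  "krylov n A b = span ((\<lambda>i. mat_power A i *v b) ` {..<n})"

text \<open>
  Singular values of a matrix with at least as many rows as columns
  (\<open>CARD('m) \<le> CARD('d)\<close>): the square roots of the eigenvalues of \<open>A\<^sup>T A\<close>.
\<close>

definition singular_values :: "real^'m^'d \<Rightarrow> real set" where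
  "singular_values A =
     {sqrt \<mu> | \<mu>. \<exists>v. v \<noteq> 0 \<and> (transpose A ** A) *v v = \<mu> *s v}"

definition sigma_min :: "real^'m^'d \<Rightarrow> real" where
  "sigma_min A = Min (singular_values A)"

text \<open>
  The matrix with columns \<open>v 0, \<dots>, v (CARD('m) - 1)\<close>. The column index type \<open>'m\<close> is
  identified with \<open>{0, \<dots>, CARD('m) - 1}\<close> by the bijection \<open>to_nat_on UNIV\<close>.
\<close>

definition cols_matrix :: "(nat \<Rightarrow> real^'d) \<Rightarrow> real^'m^'d" where
  "cols_matrix v = (\<chi> i j. v (to_nat_on (UNIV :: 'm set) j) $ i)"

definition resid :: "(real^'d \<Rightarrow> real^'d) \<Rightarrow> real^'d \<Rightarrow> real^'d" where
  "resid g x = g x - x"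

text \<open>Inner Picard iterates: \<open>picard g x l\<close> is \<open>x\<^sub>t\<^sup>l\<close> when \<open>x = x\<^sub>t\<close>.\<close>

definition picard :: "(real^'d \<Rightarrow> real^'d) \<Rightarrow> real^'d \<Rightarrow> nat \<Rightarrow> real^'d" where
  "picard g x l = (g ^^ l) x"

text \<open>
  One outer step with damping \<open>b\<close>. The mixing coefficients need not be unique; any
  solution of the constrained least squares problem is admitted.
\<close>

definition aap_step ::
    "nat \<Rightarrow> (real^'d \<Rightarrow> real^'d) \<Rightarrow> real \<Rightarrow> real^'d \<Rightarrow> real^'d \<Rightarrow> bool" where
  "aap_step m g b x x' \<longleftrightarrow>
     (\<exists>\<alpha> :: nat \<Rightarrow> real.
        is_arg_min (\<lambda>a. (norm (\<Sum>l\<le>m. a l *\<^sub>R resid g (picard g x l)))\<^sup>2)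
                   (\<lambda>a. (\<Sum>l\<le>m. a l) = 1) \<alpha> \<and>
        x' = (1 - b) *\<^sub>R (\<Sum>l\<le>m. \<alpha> l *\<^sub>R picard g x l)
             + b *\<^sub>R (\<Sum>l\<le>m. \<alpha> l *\<^sub>R g (picard g x l)))"

definition aap ::
    "nat \<Rightarrow> (real^'d \<Rightarrow> real^'d) \<Rightarrow> (nat \<Rightarrow> real) \<Rightarrow> (nat \<Rightarrow> real^'d) \<Rightarrow> bool" where
  "aap m g \<beta> x \<longleftrightarrow> (\<forall>t. \<beta> t \<ge> 0 \<and> aap_step m g (\<beta> t) (x t) (x (Suc t)))"

definition S_mat :: "(real^'d \<Rightarrow> real^'d) \<Rightarrow> real^'d \<Rightarrow> real^'m^'d" where
  "S_mat g x = cols_matrix (\<lambda>l. picard g x (Suc l) - picard g x l)"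

definition Y_mat :: "(real^'d \<Rightarrow> real^'d) \<Rightarrow> real^'d \<Rightarrow> real^'m^'d" where
  "Y_mat g x = cols_matrix (\<lambda>l. resid g (picard g x (Suc l)) - resid g (picard g x l))"

definition J_mat :: "(real^'d \<Rightarrow> real^'d) \<Rightarrow> real^'d \<Rightarrow> real^'d^'d" where
  "J_mat g x = jacobian (resid g) (at x)"

definition G_mat :: "(real^'d \<Rightarrow> real^'d) \<Rightarrow> real^'d \<Rightarrow> real^'m^'d" where
  "G_mat g x = cols_matrix (\<lambda>l. mat_power (jacobian g (at x)) l *v resid g x)"

definition multisecant :: "real^'m^'d \<Rightarrow> real^'m^'d \<Rightarrow> (real^'d^'d) set" where
  "multisecant S Y = {B. B ** S = Y}"

end

theory Submission
  imports Defs
begin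

text \<open>
  Both directions are least squares solutions over a Krylov space: \<open>p_hat = S c\<close> with \<open>c\<close>
  minimizing \<open>\<parallel>Y c - f\<parallel>\<close>, and \<open>p_N = G c'\<close> with \<open>c'\<close> minimizing \<open>\<parallel>J G c' - f\<parallel>\<close>. Linearizing \<open>g\<close>
  along the Picard iterates shows that \<open>S - G\<close> and \<open>Y - J G\<close> are \<open>O(\<parallel>f\<parallel>\<^sup>2)\<close>, while
  \<open>\<sigma>\<^sub>m\<^sub>i\<^sub>n(Y) \<ge> M \<parallel>f\<parallel>\<close>. Hence \<open>c\<close> is bounded, \<open>c - c'\<close> is \<open>O(\<parallel>f\<parallel>)\<close>, and since \<open>G\<close> is \<open>O(\<parallel>f\<parallel>)\<close> the
  directions differ by \<open>O(\<parallel>f\<parallel>\<^sup>2)\<close>.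
\<close>

section \<open>Singular values as lower bounds for the stretching of vectors\<close>

lemma inner_gram:
  fixes A :: "real^'m^'d"
  shows "((transpose A ** A) *v v) \<bullet> w = (A *v v) \<bullet> (A *v w)"
  by (simp add: dot_lmul_matrix flip: matrix_vector_mul_assoc)

text \<open>\<open>sigma_min\<close> is a \<open>Min\<close>, which is informative only for a finite
  set. Eigenvectors of the symmetric Gram matrix for distinct eigenvalues are orthogonal, and an
  orthogonal set in a Euclidean space is finite.\<close>

lemma finite_singular_values: "finite (singular_values (A :: real^'m^'d))"
proof -
  let ?N = "transpose A ** A"
  let ?E = "{\<mu>. \<exists>v. v \<noteq> 0 \<and> ?N *v v = \<mu> *s v}"
  define e where "e \<mu> = (SOME v. v \<noteq> 0 \<and> ?N *v v = \<mu> *s v)" for \<mu>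
  have e: "e \<mu> \<noteq> 0 \<and> ?N *v e \<mu> = \<mu> *s e \<mu>" if "\<mu> \<in> ?E" for \<mu>
  proof -
    have "\<exists>v. v \<noteq> 0 \<and> ?N *v v = \<mu> *s v" using that by (rule CollectD)
    then show ?thesis unfolding e_def by (rule someI_ex)
  qed
  have orth: "e a \<bullet> e b = 0" if "a \<in> ?E" "b \<in> ?E" "a \<noteq> b" for a b
  proof -
    have "(?N *v e a) \<bullet> e b = e a \<bullet> (?N *v e b)"
      by (simp add: inner_gram inner_commute[of "e a"] inner_commute[of "A *v e a"])
    then have "a * (e a \<bullet> e b) = b * (e a \<bullet> e b)"
      using e[OF that(1)] e[OF that(2)] by (simp add: scalar_mult_eq_scaleR)
    then show ?thesis using \<open>a \<noteq> b\<close> by simp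
  qed
  have inj: "inj_on e ?E"
  proof (rule inj_onI, rule ccontr)
    fix a b assume "a \<in> ?E" "b \<in> ?E" "e a = e b" "a \<noteq> b"
    then have "e a \<bullet> e a = 0" using orth[of a b] by simp
    then show False using e[OF \<open>a \<in> ?E\<close>] by simp
  qed
  have "pairwise orthogonal (e ` ?E)"
    unfolding pairwise_image by (auto simp: pairwise_def orthogonal_def intro!: orth)
  then have "finite (e ` ?E)"
    by (rule pairwise_orthogonal_imp_finite)
  then have "finite ?E" using inj finite_imageD by blast
  moreover have "singular_values A = sqrt ` ?E"
    unfolding singular_values_def by blast
  ultimately show ?thesis by simp
qed

text \<open>If \<open>N v\<close> were nonzero, a short step from \<open>v\<close> in direction
  \<open>- N v\<close> would make the form negative. This is what turns a minimizer of the Rayleigh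
  quotient into an eigenvector.\<close>

lemma psd_form_zero_imp_kernel:
  fixes N :: "'a::real_inner \<Rightarrow> 'a"
  assumes lin: "linear N" and sym: "\<And>v w. N v \<bullet> w = v \<bullet> N w"
    and psd: "\<And>v. N v \<bullet> v \<ge> 0" and zero: "N v \<bullet> v = 0"
  shows "N v = 0"
proof -
  define a where "a = N v \<bullet> N v"
  define b where "b = N (N v) \<bullet> N v"
  \<comment> \<open>The \<open>+ 1\<close> guards against division by zero. With
    \<open>a = r (b + 1)\<close> the form at the shifted vector is \<open>- r^2 (b + 2)\<close>,
    which forces \<open>r = 0\<close>.\<close>
  define r where "r = a / (b + 1)"
  have b: "b \<ge> 0" unfolding b_def by (rule psd)
  have "N (v - r *\<^sub>R N v) \<bullet> (v - r *\<^sub>R N v) = r\<^sup>2 * b - 2 * r * a"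
    using zero sym[of "N v" v]
    by (simp add: linear_diff[OF lin] linear_scale[OF lin] inner_diff_left inner_diff_right
        a_def b_def power2_eq_square algebra_simps)
  then have "r\<^sup>2 * b - 2 * r * a \<ge> 0" by (metis psd)
  moreover have "a = r * (b + 1)" using b by (simp add: r_def)
  ultimately have "r\<^sup>2 * (b + 2) \<le> 0"
    by (simp add: power2_eq_square algebra_simps)
  then have "r = 0"
    using b by (smt (verit) mult_pos_pos zero_less_power2)
  then have "a = 0" using \<open>a = r * (b + 1)\<close> by simp
  then show ?thesis by (simp add: a_def)
qed

text \<open>By compactness \<open>norm (A *v v)\<close> attains its minimum on the unit sphere at
  some \<open>e\<close>. Subtracting \<mu> times the identity from the Gram matrix, with \<mu> the
  squared minimum, leaves a positive semidefinite form that vanishes at \<open>e\<close>. So \<mu>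
  is an eigenvalue, and \<open>sigma_min A\<close> is at most its root.\<close>

lemma sigma_min_le:
  fixes A :: "real^'m^'d"
  shows "sigma_min A * norm v \<le> norm (A *v v)"
proof -
  let ?S = "sphere (0 :: real^'m) 1"
  have "continuous_on ?S (\<lambda>v. norm (A *v v))"
    by (intro continuous_intros linear_continuous_on) simp
  moreover have "?S \<noteq> {}" by simp
  ultimately obtain e where e: "e \<in> ?S" and min: "\<And>v. v \<in> ?S \<Longrightarrow> norm (A *v e) \<le> norm (A *v v)"
    using continuous_attains_inf[OF compact_sphere] by metis
  define \<mu> where "\<mu> = (norm (A *v e))\<^sup>2"
  have bound: "norm (A *v e) * norm v \<le> norm (A *v v)" for v
  proof (cases "v = 0")
    case False
    then have "norm (A *v e) \<le> norm (A *v ((1 / norm v) *\<^sub>R v))"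
      by (intro min) simp
    then show ?thesis using False
      by (simp add: matrix_vector_mult_scaleR field_simps)
  qed simp
  have "(transpose A ** A) *v e - \<mu> *\<^sub>R e = 0"
  proof (rule psd_form_zero_imp_kernel[where N = "\<lambda>v. (transpose A ** A) *v v - \<mu> *\<^sub>R v"])
    show "linear (\<lambda>v. (transpose A ** A) *v v - \<mu> *\<^sub>R v)"
      by (intro linear_compose_sub linear_scaleR) simp
    show "((transpose A ** A) *v v - \<mu> *\<^sub>R v) \<bullet> w = v \<bullet> ((transpose A ** A) *v w - \<mu> *\<^sub>R w)" for v w
      by (simp add: inner_diff_left inner_diff_right inner_gram)
        (metis inner_gram inner_commute)
    show "((transpose A ** A) *v v - \<mu> *\<^sub>R v) \<bullet> v \<ge> 0" for v
      using power_mono[OF bound[of v], of 2]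
      by (simp add: inner_diff_left inner_gram \<mu>_def power_mult_distrib flip: power2_norm_eq_inner)
    show "((transpose A ** A) *v e - \<mu> *\<^sub>R e) \<bullet> e = 0"
      using e by (simp add: inner_diff_left inner_gram \<mu>_def flip: power2_norm_eq_inner)
  qed
  then have "sqrt \<mu> \<in> singular_values A"
    using e unfolding singular_values_def
    by (intro CollectI exI[of _ \<mu>] exI[of _ e] conjI) (auto simp: scalar_mult_eq_scaleR)
  then have "sigma_min A \<le> norm (A *v e)"
    unfolding sigma_min_def using Min_le[OF finite_singular_values] by (fastforce simp: \<mu>_def)
  then show ?thesis
    using bound[of v] mult_right_mono[of "sigma_min A" "norm (A *v e)" "norm v"] by simp
qed

section \<open>Matrices given by their columns\<close>

lemma cols_matrix_mult_vec:
  "(cols_matrix v :: real^'m^'d) *v c = (\<Sum>j\<in>UNIV. c $ j *\<^sub>R v (to_nat_on UNIV j))"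
  by (simp add: cols_matrix_def matrix_vector_mult_def vec_eq_iff mult.commute)

lemma matrix_mult_cols_matrix:
  "B ** (cols_matrix v :: real^'m^'d) = cols_matrix (\<lambda>l. B *v v l)"
  by (simp add: cols_matrix_def matrix_matrix_mult_def matrix_vector_mult_def vec_eq_iff)

lemma bij_betw_to_nat_on_UNIV:
  "bij_betw (to_nat_on (UNIV :: 'm::finite set)) UNIV {..<CARD('m)}"
  by (rule to_nat_on_finite) simp

lemma cols_matrix_eqD:
  assumes "(cols_matrix v :: real^'m^'d) = cols_matrix w" "l < CARD('m)"
  shows "v l = w l"
proof -
  obtain j :: 'm where "l = to_nat_on UNIV j"
    using assms(2) bij_betw_to_nat_on_UNIV[where 'm='m] unfolding bij_betw_def by blast
  then show ?thesis using assms(1) by (simp add: cols_matrix_def vec_eq_iff)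
qed

text \<open>Parametrizing a span by coefficient vectors lets minimization over a Krylov space become
  an unconstrained least squares problem.\<close>

lemma range_cols_matrix:
  "range ((*v) (cols_matrix v :: real^'m^'d)) = span (v ` {..<CARD('m)})"
proof
  have idx: "to_nat_on (UNIV :: 'm set) j < CARD('m)" for j
    using bij_betw_to_nat_on_UNIV[where 'm='m] unfolding bij_betw_def by blast
  show "range ((*v) (cols_matrix v :: real^'m^'d)) \<subseteq> span (v ` {..<CARD('m)})"
    by (intro image_subsetI, unfold cols_matrix_mult_vec)
      (intro span_sum span_scale span_base imageI, simp add: idx)
  have "v l \<in> range ((*v) (cols_matrix v :: real^'m^'d))" if l: "l < CARD('m)" for l
  proof -
    obtain j :: 'm where "l = to_nat_on UNIV j"
      using l bij_betw_to_nat_on_UNIV[where 'm='m] unfolding bij_betw_def by blast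
    moreover have "(cols_matrix v :: real^'m^'d) *v axis j 1 = v (to_nat_on UNIV j)"
      by (simp add: cols_matrix_mult_vec axis_def if_distrib[of "\<lambda>a. a *\<^sub>R _"] cong: if_cong)
    ultimately show ?thesis by (metis rangeI)
  qed
  then show "span (v ` {..<CARD('m)}) \<subseteq> range ((*v) (cols_matrix v :: real^'m^'d))"
    by (intro span_minimal linear_subspace_image) auto
qed

text \<open>Every coefficient is at most \<open>norm c\<close>, so the triangle inequality over the
  columns suffices. Each use puts one factor \<open>m\<close> into the later constants.\<close>

lemma norm_cols_matrix_mult_le:
  fixes \<delta> :: real
  assumes "\<And>l. l < CARD('m) \<Longrightarrow> norm (v l) \<le> \<delta>"
  shows "norm ((cols_matrix v :: real^'m^'d) *v c) \<le> CARD('m) * \<delta> * norm c"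
proof -
  have idx: "to_nat_on (UNIV :: 'm set) j < CARD('m)" for j
    using bij_betw_to_nat_on_UNIV[where 'm='m] unfolding bij_betw_def by blast
  have "norm ((cols_matrix v :: real^'m^'d) *v c) \<le> (\<Sum>j\<in>(UNIV :: 'm set). norm c * \<delta>)"
    unfolding cols_matrix_mult_vec
    by (intro sum_norm_le) (auto intro!: mult_mono component_le_norm_cart assms idx)
  then show ?thesis by (simp add: mult_ac)
qed

lemma cols_matrix_diff_mult_vec:
  "(cols_matrix v :: real^'m^'d) *v c - cols_matrix w *v c = cols_matrix (\<lambda>l. v l - w l) *v c"
  by (simp add: cols_matrix_mult_vec sum_subtractf scaleR_diff_right)

section \<open>Krylov spaces\<close>

text \<open>The recursion reads \<open>v (Suc l) = (B + I) v l\<close>, and \<open>B + I\<close> and \<open>B\<close> have the same Krylov spaces.\<close>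

lemma krylov_eq_span_shifted:
  assumes "v 0 = b" "\<And>l. Suc l < n \<Longrightarrow> v (Suc l) = v l + B *v v l"
  shows "krylov n B b = span (v ` {..<n})"
  using assms(2)
proof (induction n)
  case 0
  then show ?case by (simp add: krylov_def)
next
  case (Suc n)
  show ?case
  \<comment> \<open>The recursion can be applied only once a previous vector exists, so the first
    vector \<open>v 0 = b\<close> is treated apart.\<close>
  proof (cases n)
    case 0
    then show ?thesis by (simp add: krylov_def assms(1))
  next
    case (Suc k)
    let ?P = "\<lambda>i. mat_power B i *v b"
    have IH: "span (?P ` {..<n}) = span (v ` {..<n})"
      using Suc.IH Suc.prems by (simp add: krylov_def)
    have vstep: "B *v v l = v (Suc l) - v l" if "l < n" for l
      using Suc.prems[of l] that by simp
    \<comment> \<open>\<open>B\<close> maps each of the two spans of order \<open>n\<close> into the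
      span of order \<open>Suc n\<close> of the same family. As the spans of order \<open>n\<close>
      agree by induction, each new generator lies in the other larger span.\<close>
    have BP: "B *v w \<in> span (?P ` {..<Suc n})" if "w \<in> span (?P ` {..<n})" for w
      using that
    proof (induction rule: span_induct_alt)
      case (step a y z)
      then obtain i where "i < n" "y = ?P i" by auto
      then have "B *v y = ?P (Suc i)" "Suc i < Suc n" by (simp_all add: matrix_vector_mul_assoc)
      then have "B *v y \<in> span (?P ` {..<Suc n})" by (metis imageI lessThan_iff span_base)
      then show ?case
        using step by (simp add: matrix_vector_right_distrib matrix_vector_mult_scaleR span_add span_scale)
    qed (simp add: span_zero)
    have BV: "B *v w \<in> span (v ` {..<Suc n})" if "w \<in> span (v ` {..<n})" for w
      using that
    proof (induction rule: span_induct_alt)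
      case (step a y z)
      then obtain i where i: "i < n" "y = v i" by auto
      then have "B *v y \<in> span (v ` {..<Suc n})"
        by (simp add: vstep span_diff span_base)
      then show ?case
        using step by (simp add: matrix_vector_right_distrib matrix_vector_mult_scaleR span_add span_scale)
    qed (simp add: span_zero)
    have mono: "span (w ` {..<n}) \<subseteq> span (w ` {..<Suc n})" for w :: "nat \<Rightarrow> real^'a"
      by (intro span_mono image_mono) auto
    have vk: "v k \<in> span (?P ` {..<n})" unfolding IH using Suc by (auto intro: span_base)
    have vn: "v n \<in> span (?P ` {..<Suc n})"
      using span_add[OF subsetD[OF mono vk] BP[OF vk]] Suc.prems[of k] Suc by simp
    have Pk: "?P k \<in> span (v ` {..<n})" unfolding IH[symmetric] using Suc by (auto intro: span_base)
    have Pn: "?P n \<in> span (v ` {..<Suc n})"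
      using BV[OF Pk] Suc by (simp add: matrix_vector_mul_assoc)
    have "v ` {..<n} \<subseteq> span (?P ` {..<Suc n})"
      using mono[of ?P] span_superset[of "v ` {..<n}"] IH by blast
    moreover have "?P ` {..<n} \<subseteq> span (v ` {..<Suc n})"
      using mono[of v] span_superset[of "?P ` {..<n}"] IH by blast
    ultimately have "span (?P ` {..<Suc n}) = span (v ` {..<Suc n})"
      using vn Pn unfolding span_eq by (simp add: lessThan_Suc)
    then show ?thesis by (simp add: krylov_def)
  qed
qed

section \<open>Least squares problems and their perturbation\<close>

text \<open>These are the normal equations: a residual with a component along \<open>Y v\<close>
  could be shortened by moving \<open>c\<close> along \<open>v\<close>.\<close>

lemma least_squares_orthogonal:
  fixes Y :: "'a::real_vector \<Rightarrow> 'b::real_inner"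
  assumes lin: "linear Y" and min: "\<And>v. norm (Y c - u) \<le> norm (Y v - u)"
  shows "Y v \<bullet> (Y c - u) = 0"
proof (rule ccontr)
  let ?r = "Y c - u"
  define a where "a = Y v \<bullet> ?r"
  define b where "b = Y v \<bullet> Y v"
  \<comment> \<open>The optimal step would be \<open>a / b\<close>. The slightly shorter one is
    defined also for \<open>Y v = 0\<close> and changes the squared norm by
    \<open>- s^2 (b + 2)\<close>.\<close>
  define s where "s = a / (b + 1)"
  assume "Y v \<bullet> ?r \<noteq> 0"
  then have a: "a \<noteq> 0" by (simp add: a_def)
  have b: "b \<ge> 0" by (simp add: b_def)
  have "(norm ?r)\<^sup>2 \<le> (norm (Y (c - s *\<^sub>R v) - u))\<^sup>2"
    using min by (intro power_mono) auto
  also have "Y (c - s *\<^sub>R v) - u = ?r - s *\<^sub>R Y v"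
    by (simp add: linear_diff[OF lin] linear_scale[OF lin])
  also have "(norm (?r - s *\<^sub>R Y v))\<^sup>2 = (norm ?r)\<^sup>2 - 2 * s * a + s\<^sup>2 * b"
    unfolding a_def b_def power2_norm_eq_inner
    by (simp only: inner_diff_left inner_diff_right inner_scaleR_left inner_scaleR_right
        power2_eq_square inner_commute algebra_simps)
  finally have "s * (2 * a - s * b) \<le> 0" by (simp add: power2_eq_square algebra_simps)
  moreover have "a = s * (b + 1)" using b by (simp add: s_def)
  ultimately have "s\<^sup>2 * (b + 2) \<le> 0"
    by (simp add: power2_eq_square algebra_simps)
  then have "s = 0"
    using b by (smt (verit) mult_pos_pos zero_less_power2)
  then show False using \<open>a = s * (b + 1)\<close> a by simp
qed

text \<open>The normal equations of both problems express the squared norm of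
  \<open>Z (c' - c)\<close> through the differences of \<open>Y\<close> and \<open>Z\<close> at
  \<open>c' - c\<close> and at \<open>c\<close>, each of first order in \<delta>. The condition
  \<open>2 * \<delta> \<le> \<mu>\<close> leaves \<open>Z\<close> half of the lower bound of
  \<open>Y\<close>.\<close>

lemma least_squares_perturbation:
  fixes Y Z :: "'a::real_normed_vector \<Rightarrow> 'b::real_inner"
  assumes lin: "linear Y" "linear Z"
    and minY: "\<And>v. norm (Y c - u) \<le> norm (Y v - u)"
    and minZ: "\<And>v. norm (Z c' - u) \<le> norm (Z v - u)"
    and low: "\<mu> > 0" "\<And>v. \<mu> * norm v \<le> norm (Y v)"
    and close: "\<delta> \<ge> 0" "\<And>v. norm (Y v - Z v) \<le> \<delta> * norm v" "2 * \<delta> \<le> \<mu>"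
  shows "norm c \<le> norm u / \<mu>" and "norm (c' - c) \<le> 6 * \<delta> * norm u / \<mu>\<^sup>2"
proof -
  have orthY: "Y v \<bullet> (Y c - u) = 0" for v
    using least_squares_orthogonal[OF lin(1) minY] .
  have orthZ: "Z v \<bullet> (Z c' - u) = 0" for v
    using least_squares_orthogonal[OF lin(2) minZ] .
  have "(norm (Y c))\<^sup>2 = Y c \<bullet> u"
    using orthY[of c] by (simp add: inner_diff_right power2_norm_eq_inner)
  also have "\<dots> \<le> norm (Y c) * norm u" by (rule norm_cauchy_schwarz)
  finally have "norm (Y c) \<le> norm u"
    by (cases "Y c = 0") (simp_all add: power2_eq_square)
  then have "\<mu> * norm c \<le> norm u" using low(2)[of c] by linarith
  then show c: "norm c \<le> norm u / \<mu>" using low(1) by (simp add: field_simps)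
  have res: "norm (u - Y c) \<le> norm u"
    using minY[of 0] by (simp add: linear_0[OF lin(1)] norm_minus_commute)
  define e where "e = c' - c"
  have Zlow: "\<mu> / 2 * norm e \<le> norm (Z e)"
  proof -
    have "\<delta> * norm e \<le> \<mu> / 2 * norm e" using close(3) by (intro mult_right_mono) auto
    then show ?thesis
      using low(2)[of e] close(2)[of e] norm_triangle_ineq2[of "Y e" "Z e"]
      by (simp add: algebra_simps)
  qed
  then have e: "norm e \<le> 2 / \<mu> * norm (Z e)" using low(1) by (simp add: field_simps)
  have "(norm (Z e))\<^sup>2 = Z e \<bullet> (u - Z c)"
    using orthZ[of e] unfolding e_def
    by (simp add: power2_norm_eq_inner linear_diff[OF lin(2)] inner_diff_left inner_diff_right)
  also have "\<dots> = (Y e - Z e) \<bullet> (Y c - u) + Z e \<bullet> (Y c - Z c)"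
    using orthY[of e] by (simp add: inner_diff_left inner_diff_right)
  also have "\<dots> \<le> norm (Y e - Z e) * norm (Y c - u) + norm (Z e) * norm (Y c - Z c)"
    by (intro add_mono norm_cauchy_schwarz)
  also have "\<dots> \<le> (\<delta> * norm e) * norm u + norm (Z e) * (\<delta> * norm c)"
    using res close by (intro add_mono mult_mono) (auto simp: norm_minus_commute)
  also have "\<dots> \<le> (\<delta> * (2 / \<mu> * norm (Z e))) * norm u + norm (Z e) * (\<delta> * (norm u / \<mu>))"
    using e c close(1) low(1) by (intro add_mono mult_mono mult_nonneg_nonneg order_refl) auto
  \<comment> \<open>Of the factor 3, two come from the bound on \<open>norm e\<close> and one from
    the bound on \<open>norm c\<close>.\<close>
  also have "\<dots> = norm (Z e) * (3 * \<delta> * norm u / \<mu>)" by (simp add: field_simps)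
  finally have "norm (Z e) * norm (Z e) \<le> norm (Z e) * (3 * \<delta> * norm u / \<mu>)"
    by (simp add: power2_eq_square)
  \<comment> \<open>Cancelling \<open>norm (Z e)\<close> requires it to be nonzero; if it vanishes,
    nonnegativity of the right side gives the claim.\<close>
  moreover have "0 \<le> 3 * \<delta> * norm u / \<mu>" using low(1) close(1) by simp
  ultimately have "norm (Z e) \<le> 3 * \<delta> * norm u / \<mu>"
    by (metis mult_le_cancel_left_pos norm_zero zero_less_norm_iff)
  then have "2 / \<mu> * norm (Z e) \<le> 2 / \<mu> * (3 * \<delta> * norm u / \<mu>)"
    using low(1) by (intro mult_left_mono) auto
  with e show "norm (c' - c) \<le> 6 * \<delta> * norm u / \<mu>\<^sup>2"
    by (simp add: e_def power2_eq_square)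
qed

section \<open>Linearization of \<open>g\<close> along the Picard iterates\<close>

text \<open>The mean value inequality is applied to \<open>g\<close> minus its linear part at
  \<open>x\<close>; on the ball of radius \<open>R\<close> around \<open>x\<close> the derivative of
  this map is at most \<open>\<gamma> * R\<close>. The Jacobian stays at \<open>x\<close> although
  the increment is between \<open>u\<close> and \<open>v\<close>, so that powers of one matrix
  arise.\<close>

lemma norm_linearization_le:
  fixes g :: "real^'d \<Rightarrow> real^'d"
  assumes diff: "\<And>u. g differentiable (at u)"
    and lip: "\<And>u v. onorm ((*v) (jacobian g (at u) - jacobian g (at v))) \<le> \<gamma> * norm (u - v)"
    and "\<gamma> \<ge> 0" "norm (u - x) \<le> R" "norm (v - x) \<le> R"
  shows "norm (g u - g v - jacobian g (at x) *v (u - v)) \<le> \<gamma> * R * norm (u - v)"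
proof -
  let ?A = "jacobian g (at x)"
  have "norm ((g u - ?A *v u) - (g v - ?A *v v)) \<le> \<gamma> * R * norm (u - v)"
  proof (rule differentiable_bound[where S = "cball x R"])
    fix y assume y: "y \<in> cball x R"
    have "(g has_derivative (*v) (jacobian g (at y))) (at y)"
      using diff jacobian_works by blast
    then have "((\<lambda>y. g y - ?A *v y) has_derivative (\<lambda>h. jacobian g (at y) *v h - ?A *v h)) (at y)"
      by (intro has_derivative_diff bounded_linear_imp_has_derivative matrix_vector_mul_bounded_linear)
    then show "((\<lambda>y. g y - ?A *v y) has_derivative (*v) (jacobian g (at y) - ?A)) (at y within cball x R)"
      by (simp add: matrix_vector_mult_diff_rdistrib[abs_def] has_derivative_at_withinI)
    have "onorm ((*v) (jacobian g (at y) - ?A)) \<le> \<gamma> * norm (y - x)" by (rule lip)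
    also have "\<dots> \<le> \<gamma> * R"
      using y \<open>\<gamma> \<ge> 0\<close> by (intro mult_left_mono) (auto simp: dist_norm norm_minus_commute)
    finally show "onorm ((*v) (jacobian g (at y) - ?A)) \<le> \<gamma> * R" .
  qed (use assms in \<open>auto simp: dist_norm norm_minus_commute\<close>)
  then show ?thesis by (simp add: matrix_vector_mult_diff_distrib algebra_simps)
qed

text \<open>Difference quotients of a nonexpansive map in direction \<open>h\<close> have norm at
  most \<open>norm h\<close>, and the derivative is their limit.\<close>

lemma norm_jacobian_mult_le:
  fixes g :: "real^'d \<Rightarrow> real^'d"
  assumes diff: "g differentiable (at x)" and lip: "\<And>u v. norm (g u - g v) \<le> norm (u - v)"
  shows "norm (jacobian g (at x) *v h) \<le> norm h"
proof -
  let ?A = "jacobian g (at x)"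
  have der: "(g has_derivative (*v) ?A) (at x)"
    using diff jacobian_works by blast
  have "norm (?A *v h) \<le> norm h + e * norm h" if "e > 0" for e
  proof (cases "h = 0")
    case False
    obtain d where "d > 0" and d: "\<And>y. norm (y - x) < d \<Longrightarrow>
        norm (g y - g x - ?A *v (y - x)) \<le> e * norm (y - x)"
      using der \<open>e > 0\<close> unfolding has_derivative_at_alt by blast
    \<comment> \<open>Half of the radius \<open>d\<close>, so that \<open>r *\<^sub>R h\<close> has
      norm strictly below \<open>d\<close>.\<close>
    define r where "r = d / (2 * norm h)"
    have r: "r > 0" "norm (r *\<^sub>R h) < d"
      using \<open>d > 0\<close> False by (simp_all add: r_def)
    have "norm (g (x + r *\<^sub>R h) - g x - ?A *v (r *\<^sub>R h)) \<le> e * norm (r *\<^sub>R h)"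
      using d[of "x + r *\<^sub>R h"] r by simp
    moreover have "norm (g (x + r *\<^sub>R h) - g x) \<le> norm (r *\<^sub>R h)"
      using lip[of "x + r *\<^sub>R h" x] by simp
    ultimately have "norm (?A *v (r *\<^sub>R h)) \<le> norm (r *\<^sub>R h) + e * norm (r *\<^sub>R h)"
      using norm_triangle_sub[of "?A *v (r *\<^sub>R h)" "g (x + r *\<^sub>R h) - g x"]
      by (simp add: norm_minus_commute)
    then have "r * norm (?A *v h) \<le> r * (norm h + e * norm h)"
      using r by (simp add: matrix_vector_mult_scaleR algebra_simps)
    then show ?thesis using r by simp
  qed simp
  note bound = this
  show ?thesis
  proof (cases "h = 0")
    case False
    then have "norm (?A *v h) \<le> norm h + e" if "e > 0" for e
      using bound[of "e / norm h"] that by simp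
    then show ?thesis by (rule field_le_epsilon)
  qed simp
qed

lemma jacobian_resid:
  assumes "g differentiable (at x)"
  shows "J_mat g x = jacobian g (at x) - mat 1"
proof -
  have "(resid g has_derivative (*v) (jacobian g (at x) - mat 1)) (at x)"
    using assms jacobian_works[of g "at x"] unfolding resid_def matrix_vector_mult_diff_rdistrib
    by (auto intro: has_derivative_diff)
  then have "frechet_derivative (resid g) (at x) = (*v) (jacobian g (at x) - mat 1)"
    by (rule frechet_derivative_at[symmetric])
  then show ?thesis by (simp add: J_mat_def jacobian_def)
qed

lemma picard_Suc: "picard g x (Suc l) = g (picard g x l)"
  by (simp add: picard_def)

text \<open>The residual at a Picard iterate is the increment to the next iterate, and
  \<open>g\<close> does not lengthen increments.\<close>

lemma norm_resid_picard_le: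
  assumes lip: "\<And>u v. norm (g u - g v) \<le> norm (u - v)"
  shows "norm (resid g (picard g x l)) \<le> norm (resid g x)"
proof (induction l)
  case (Suc l)
  then show ?case
    using lip[of "g (picard g x l)" "picard g x l"] by (simp add: picard_Suc resid_def)
qed (simp add: picard_def)

lemma norm_picard_diff_le:
  assumes lip: "\<And>u v. norm (g u - g v) \<le> norm (u - v)"
  shows "norm (picard g x l - x) \<le> l * norm (resid g x)"
proof (induction l)
  case (Suc l)
  have "picard g x (Suc l) - x = resid g (picard g x l) + (picard g x l - x)"
    by (simp add: picard_Suc resid_def)
  then show ?case
    using Suc norm_resid_picard_le[OF lip, of x l]
      norm_triangle_ineq[of "resid g (picard g x l)" "picard g x l - x"]
    by (simp add: algebra_simps)
qed (simp add: picard_def)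

text \<open>Each increment is nearly the Jacobian at \<open>x\<close> applied to the previous one.
  Step \<open>Suc l\<close> adds a linearization error with factor \<open>Suc l\<close>, and the
  Jacobian does not enlarge the earlier error. The square absorbs the sum, since
  \<open>l + 1 + l^2 \<le> (l + 1)^2\<close>.\<close>

lemma norm_resid_picard_diff_power_le:
  fixes g :: "real^'d \<Rightarrow> real^'d"
  assumes diff: "\<And>u. g differentiable (at u)"
    and lip: "\<And>u v. norm (g u - g v) \<le> norm (u - v)"
    and lip': "\<And>u v. onorm ((*v) (jacobian g (at u) - jacobian g (at v))) \<le> \<gamma> * norm (u - v)"
    and "\<gamma> \<ge> 0"
  shows "norm (resid g (picard g x l) - mat_power (jacobian g (at x)) l *v resid g x)
           \<le> \<gamma> * (real l)\<^sup>2 * (norm (resid g x))\<^sup>2"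
proof (induction l)
  case (Suc l)
  let ?A = "jacobian g (at x)"
  let ?f = "resid g x"
  let ?s = "resid g (picard g x l)"
  let ?P = "mat_power ?A l *v ?f"
  have near: "norm (picard g x i - x) \<le> real (Suc l) * norm ?f" if "i \<le> Suc l" for i
    using norm_picard_diff_le[OF lip, of x i] that
    by (smt (verit) mult_right_mono norm_ge_zero of_nat_mono)
  have "norm (resid g (picard g x (Suc l)) - ?A *v ?s)
      \<le> \<gamma> * (real (Suc l) * norm ?f) * norm ?s"
    using norm_linearization_le[OF diff lip' \<open>\<gamma> \<ge> 0\<close> near[of "Suc l"] near[of l]]
    by (simp add: picard_Suc resid_def)
  also have "\<dots> \<le> \<gamma> * (real (Suc l) * norm ?f) * norm ?f"
    using \<open>\<gamma> \<ge> 0\<close> by (intro mult_left_mono norm_resid_picard_le[OF lip]) auto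
  finally have 1: "norm (resid g (picard g x (Suc l)) - ?A *v ?s) \<le> \<gamma> * real (Suc l) * (norm ?f)\<^sup>2"
    by (simp add: power2_eq_square mult_ac)
  have 2: "norm (?A *v ?s - ?A *v ?P) \<le> \<gamma> * (real l)\<^sup>2 * (norm ?f)\<^sup>2"
    using norm_jacobian_mult_le[OF diff lip, of x "?s - ?P"] Suc
    by (simp add: matrix_vector_mult_diff_distrib)
  have "resid g (picard g x (Suc l)) - mat_power ?A (Suc l) *v ?f
      = (resid g (picard g x (Suc l)) - ?A *v ?s) + (?A *v ?s - ?A *v ?P)"
    by (simp add: matrix_vector_mul_assoc)
  then have "norm (resid g (picard g x (Suc l)) - mat_power ?A (Suc l) *v ?f)
      \<le> \<gamma> * real (Suc l) * (norm ?f)\<^sup>2 + \<gamma> * (real l)\<^sup>2 * (norm ?f)\<^sup>2"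
    using norm_triangle_ineq 1 2 by (smt (verit))
  also have "\<dots> = \<gamma> * (norm ?f)\<^sup>2 * (real (Suc l) + (real l)\<^sup>2)"
    by (simp add: algebra_simps)
  also have "\<dots> \<le> \<gamma> * (norm ?f)\<^sup>2 * (real (Suc l))\<^sup>2"
    using \<open>\<gamma> \<ge> 0\<close> by (intro mult_left_mono) (auto simp: power2_eq_square algebra_simps)
  finally show ?case by (simp add: mult_ac)
qed (simp add: picard_def)

section \<open>Comparison of the two directions at one outer iterate\<close>

lemma norm_mat_power_mult_le:
  assumes "\<And>h. norm (A *v h) \<le> norm h"
  shows "norm (mat_power A l *v b) \<le> norm b"
proof (induction l)
  case (Suc l)
  then show ?case
    using assms[of "mat_power A l *v b"] by (simp flip: matrix_vector_mul_assoc)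
qed simp

text \<open>The bound is quadratic in the residual, with a constant independent of \<open>x\<close>
  and \<open>B\<close>, so it survives division by the norm of the residual.\<close>

lemma norm_direction_diff_le:
  fixes g :: "real^'d \<Rightarrow> real^'d" and B :: "real^'d^'d"
  defines "m \<equiv> CARD('m::finite)"
  assumes diff: "\<And>u. g differentiable (at u)"
    and lip: "\<And>u v. norm (g u - g v) \<le> norm (u - v)"
    and lip': "\<And>u v. onorm ((*v) (jacobian g (at u) - jacobian g (at v))) \<le> \<gamma> * norm (u - v)"
    and "\<gamma> \<ge> 0" "M > 0"
    and sigma: "sigma_min (Y_mat g x :: real^'m^'d) \<ge> M * norm (resid g x)"
    and B: "B \<in> multisecant (S_mat g x :: real^'m^'d) (Y_mat g x)"
    and p_hat: "is_arg_min (\<lambda>p. (norm (B *v p - resid g x))\<^sup>2) (\<lambda>p. p \<in> krylov m B (resid g x)) p_hat"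
    and p_N: "is_arg_min (\<lambda>p. norm (J_mat g x *v p - resid g x))
                (\<lambda>p. p \<in> krylov m (J_mat g x) (resid g x)) p_N"
    and nz: "resid g x \<noteq> 0"
    and small: "4 * \<gamma> * real m ^ 3 * norm (resid g x) \<le> M"
  shows "norm (p_hat - p_N)
           \<le> (\<gamma> * real m ^ 3 / M + 12 * \<gamma> * real m ^ 4 / M\<^sup>2) * (norm (resid g x))\<^sup>2"
proof -
  let ?f = "resid g x"
  let ?A = "jacobian g (at x)"
  let ?J = "J_mat g x"
  define s where "s l = resid g (picard g x l)" for l
  define k where "k l = mat_power ?A l *v ?f" for l
  let ?S = "cols_matrix s :: real^'m^'d"
  let ?Y = "cols_matrix (\<lambda>l. s (Suc l) - s l) :: real^'m^'d"
  let ?G = "cols_matrix k :: real^'m^'d"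
  let ?Z = "cols_matrix (\<lambda>l. ?J *v k l) :: real^'m^'d"
  have S: "S_mat g x = ?S"
    by (simp add: S_mat_def s_def[abs_def] resid_def picard_Suc)
  have Y: "Y_mat g x = ?Y"
    by (simp add: Y_mat_def s_def)
  have BS: "B ** ?S = ?Y" using B by (simp add: multisecant_def S Y)
  have Bs: "B *v s l = s (Suc l) - s l" if "l < m" for l
    using cols_matrix_eqD[OF BS[unfolded matrix_mult_cols_matrix]] that by (simp add: m_def)
  \<comment> \<open>Since \<open>?J\<close> is \<open>?A\<close> minus the identity, the Newton side
    obeys the same shifted recursion as the multisecant side in \<open>Bs\<close>.\<close>
  have Jk: "?J *v k l = k (Suc l) - k l" for l
    by (simp add: jacobian_resid[OF diff] k_def matrix_vector_mult_diff_rdistrib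
        flip: matrix_vector_mul_assoc)
  have KB: "krylov m B ?f = range ((*v) ?S)"
    unfolding range_cols_matrix m_def[symmetric]
    by (rule krylov_eq_span_shifted) (simp_all add: Bs, simp add: s_def picard_def)
  have KJ: "krylov m ?J ?f = range ((*v) ?G)"
    unfolding range_cols_matrix m_def[symmetric]
    by (rule krylov_eq_span_shifted) (simp_all add: Jk, simp add: k_def)
  obtain c where c: "p_hat = ?S *v c" using p_hat KB by (auto simp: is_arg_min_def)
  obtain c' where c': "p_N = ?G *v c'" using p_N KJ by (auto simp: is_arg_min_def)
  have BSv: "B *v (?S *v v) = ?Y *v v" for v by (simp add: matrix_vector_mul_assoc BS)
  have JGv: "?J *v (?G *v v) = ?Z *v v" for v
    by (simp add: matrix_vector_mul_assoc matrix_mult_cols_matrix)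
  have minY: "norm (?Y *v c - ?f) \<le> norm (?Y *v v - ?f)" for v
  proof -
    have "?S *v v \<in> krylov m B ?f" by (simp add: KB)
    then have "(norm (B *v p_hat - ?f))\<^sup>2 \<le> (norm (B *v (?S *v v) - ?f))\<^sup>2"
      using p_hat unfolding is_arg_min_linorder by blast
    then show ?thesis unfolding c BSv by (rule power2_le_imp_le) simp
  qed
  have minZ: "norm (?Z *v c' - ?f) \<le> norm (?Z *v v - ?f)" for v
  proof -
    have "?G *v v \<in> krylov m ?J ?f" by (simp add: KJ)
    then have "norm (?J *v p_N - ?f) \<le> norm (?J *v (?G *v v) - ?f)"
      using p_N unfolding is_arg_min_linorder by blast
    then show ?thesis unfolding c' JGv .
  qed
  define \<delta> where "\<delta> = \<gamma> * (real m)\<^sup>2 * (norm ?f)\<^sup>2"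
  have "\<delta> \<ge> 0" using \<open>\<gamma> \<ge> 0\<close> by (simp add: \<delta>_def)
  \<comment> \<open>The index \<open>m\<close> itself is included because the last column of
    \<open>?Y\<close> involves \<open>s m\<close>.\<close>
  have sk: "norm (s l - k l) \<le> \<delta>" if "l \<le> m" for l
  proof -
    have "norm (s l - k l) \<le> \<gamma> * (real l)\<^sup>2 * (norm ?f)\<^sup>2"
      unfolding s_def k_def by (rule norm_resid_picard_diff_power_le[OF diff lip lip' \<open>\<gamma> \<ge> 0\<close>])
    also have "\<dots> \<le> \<delta>"
      unfolding \<delta>_def using that \<open>\<gamma> \<ge> 0\<close> by (intro mult_right_mono mult_left_mono power_mono) auto
    finally show ?thesis .
  qed
  have YZ: "norm (?Y *v v - ?Z *v v) \<le> real m * (2 * \<delta>) * norm v" for v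
    unfolding cols_matrix_diff_mult_vec m_def
  proof (rule norm_cols_matrix_mult_le)
    fix l assume "l < CARD('m)"
    then have "norm (s (Suc l) - k (Suc l)) \<le> \<delta>" "norm (s l - k l) \<le> \<delta>"
      by (intro sk; simp add: m_def)+
    moreover have eq: "s (Suc l) - s l - ?J *v k l = (s (Suc l) - k (Suc l)) - (s l - k l)"
      by (simp add: Jk)
    ultimately show "norm (s (Suc l) - s l - ?J *v k l) \<le> 2 * \<delta>"
      using norm_triangle_ineq4[of "s (Suc l) - k (Suc l)" "s l - k l"] unfolding eq by linarith
  qed
  have low: "M * norm ?f * norm v \<le> norm (?Y *v v)" for v
    using sigma_min_le[of ?Y v] mult_right_mono[OF sigma, of "norm v"] by (simp add: Y)
  have pos: "M * norm ?f > 0" using \<open>M > 0\<close> nz by simp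
  \<comment> \<open>The hypothesis \<open>small\<close> is exactly the closeness condition of the
    perturbation lemma, with lower bound \<open>M * norm ?f\<close> and perturbation
    \<open>real m * (2 * \<delta>)\<close>, divided by \<open>norm ?f\<close>.\<close>
  have "2 * (real m * (2 * \<delta>)) = norm ?f * (4 * \<gamma> * real m ^ 3 * norm ?f)"
    by (simp add: \<delta>_def power2_eq_square power3_eq_cube)
  also have "\<dots> \<le> norm ?f * M" using small by (intro mult_left_mono) auto
  finally have sm: "2 * (real m * (2 * \<delta>)) \<le> M * norm ?f" by (simp add: mult_ac)
  note pert = least_squares_perturbation[where Y = "(*v) ?Y" and Z = "(*v) ?Z",
      OF _ _ minY minZ pos low _ YZ sm]
  \<comment> \<open>The right-hand side and the lower bound both scale with \<open>norm ?f\<close>,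
    so the coefficients stay bounded as the residual tends to zero.\<close>
  have cb: "norm c \<le> 1 / M" using pert(1) \<open>\<delta> \<ge> 0\<close> nz by simp
  have "norm (c - c') \<le> 6 * (real m * (2 * \<delta>)) * norm ?f / (M * norm ?f)\<^sup>2"
    using pert(2) \<open>\<delta> \<ge> 0\<close> by (simp add: norm_minus_commute)
  also have "\<dots> = 12 * \<gamma> * real m ^ 3 / M\<^sup>2 * norm ?f"
    using nz \<open>M > 0\<close> by (simp add: \<delta>_def field_simps power2_eq_square power3_eq_cube)
  finally have cd: "norm (c - c') \<le> 12 * \<gamma> * real m ^ 3 / M\<^sup>2 * norm ?f" .
  \<comment> \<open>The first part is the error in the columns with bounded coefficients; the second
    is the error in the coefficients with columns of size at most \<open>norm ?f\<close>. Both are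
    quadratic.\<close>
  have "p_hat - p_N = (?S *v c - ?G *v c) + ?G *v (c - c')"
    by (simp add: c c' matrix_vector_mult_diff_distrib)
  then have "norm (p_hat - p_N) \<le> norm (?S *v c - ?G *v c) + norm (?G *v (c - c'))"
    by (metis norm_triangle_ineq)
  also have "norm (?S *v c - ?G *v c) \<le> real m * \<delta> * norm c"
    unfolding cols_matrix_diff_mult_vec m_def
    by (rule norm_cols_matrix_mult_le) (simp add: sk m_def)
  also have "norm (?G *v (c - c')) \<le> real m * norm ?f * norm (c - c')"
    unfolding m_def k_def
    by (intro norm_cols_matrix_mult_le norm_mat_power_mult_le norm_jacobian_mult_le diff lip)
  also have "real m * \<delta> * norm c \<le> real m * \<delta> * (1 / M)"
    using cb \<open>\<delta> \<ge> 0\<close> by (intro mult_left_mono) auto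
  also have "real m * norm ?f * norm (c - c')
      \<le> real m * norm ?f * (12 * \<gamma> * real m ^ 3 / M\<^sup>2 * norm ?f)"
    using cd by (intro mult_left_mono) auto
  also have "real m * \<delta> * (1 / M) + real m * norm ?f * (12 * \<gamma> * real m ^ 3 / M\<^sup>2 * norm ?f)
      = (\<gamma> * real m ^ 3 / M + 12 * \<gamma> * real m ^ 4 / M\<^sup>2) * (norm ?f)\<^sup>2"
    by (simp add: \<delta>_def power2_eq_square power3_eq_cube power4_eq_xxxx algebra_simps)
  finally show ?thesis by simp
qed

section \<open>Passage to the limit\<close>

theorem corollary4p6:
  fixes g :: "real^'d \<Rightarrow> real^'d"
    and \<kappa> \<gamma> :: real
    and m :: nat
    and \<beta> :: "nat \<Rightarrow> real"
    and x :: "nat \<Rightarrow> real^'d"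
    and B :: "nat \<Rightarrow> real^'d^'d"
    and p_hat p_N :: "nat \<Rightarrow> real^'d"
  assumes m: "CARD('m::finite) = m" "1 \<le> m" "m \<le> CARD('d)"
    and g_diff: "\<And>u. g differentiable (at u)"
    and g_C1: "continuous_on UNIV (\<lambda>u. jacobian g (at u))"
    and g_lip: "\<kappa> \<le> 1" "\<And>u v. norm (g u - g v) \<le> \<kappa> * norm (u - v)"
    and g'_lip: "\<gamma> > 0"
      "\<And>u v. onorm ((*v) (jacobian g (at u) - jacobian g (at v))) \<le> \<gamma> * norm (u - v)"
    and x: "aap m g \<beta> x"
    and S_rank: "\<And>t. rank (S_mat g (x t) :: real^'m^'d) = m"
    and Y_rank: "\<And>t. rank (Y_mat g (x t) :: real^'m^'d) = m"
    and regular: "\<exists>T::real. \<exists>M::real. T > 0 \<and> M > 0 \<and>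
      (\<forall>t::nat. real t \<ge> T \<longrightarrow>
         invertible (J_mat g (x t)) \<and>
         sigma_min (Y_mat g (x t) :: real^'m^'d) \<ge> M * norm (resid g (x t)) \<and>
         rank (J_mat g (x t) ** (G_mat g (x t) :: real^'m^'d)) = m)"
    and f_lim: "(\<lambda>t. resid g (x t)) \<longlonglongrightarrow> 0"
    and B: "\<And>t. B t \<in> multisecant (S_mat g (x t) :: real^'m^'d) (Y_mat g (x t))"
    and p_hat: "\<And>t. is_arg_min (\<lambda>p. (norm (B t *v p - resid g (x t)))\<^sup>2)
                   (\<lambda>p. p \<in> krylov m (B t) (resid g (x t))) (p_hat t)"
    and p_N: "\<And>t. is_arg_min (\<lambda>p. norm (J_mat g (x t) *v p - resid g (x t)))
                   (\<lambda>p. p \<in> krylov m (J_mat g (x t)) (resid g (x t))) (p_N t)"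
  shows "(\<lambda>t. norm ((1 / norm (resid g (x t))) *\<^sub>R p_hat t
                   - (1 / norm (resid g (x t))) *\<^sub>R p_N t)) \<longlonglongrightarrow> 0"
proof -
  obtain T M :: real where M: "M > 0"
    and reg: "\<And>t::nat. real t \<ge> T \<Longrightarrow>
        sigma_min (Y_mat g (x t) :: real^'m^'d) \<ge> M * norm (resid g (x t))"
    using regular by metis
  have lip: "norm (g u - g v) \<le> norm (u - v)" for u v
    using g_lip(2)[of u v] mult_right_mono[OF g_lip(1), of "norm (u - v)"] by simp
  define f where "f t = norm (resid g (x t))" for t
  define K where "K = \<gamma> * real m ^ 3 / M + 12 * \<gamma> * real m ^ 4 / M\<^sup>2"
  have f0: "f \<longlonglongrightarrow> 0"
    unfolding f_def using tendsto_norm_zero[OF f_lim] .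
  have "(\<lambda>t. 4 * \<gamma> * real m ^ 3 * f t) \<longlonglongrightarrow> 4 * \<gamma> * real m ^ 3 * 0"
    by (intro tendsto_intros f0)
  then have "(\<lambda>t. 4 * \<gamma> * real m ^ 3 * f t) \<longlonglongrightarrow> 0" by simp
  then have small: "\<forall>\<^sub>F t in sequentially. 4 * \<gamma> * real m ^ 3 * f t < M"
    using M order_tendstoD(2) by blast
  have large: "\<forall>\<^sub>F t in sequentially. real t \<ge> T"
    using eventually_ge_at_top[of "nat \<lceil>T\<rceil>"] by eventually_elim linarith
  have "\<forall>\<^sub>F t in sequentially. norm ((1 / f t) *\<^sub>R p_hat t - (1 / f t) *\<^sub>R p_N t) \<le> K * f t"
    using small large
  proof eventually_elim
    case (elim t)
    show ?case
    \<comment> \<open>For a zero residual, \<open>1 / 0 = 0\<close> makes both scaled directions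
      vanish, and the bound reads \<open>0 \<le> 0\<close>.\<close>
    proof (cases "f t = 0")
      case False
      then have "norm (p_hat t - p_N t) \<le> K * (f t)\<^sup>2"
        using norm_direction_diff_le[where 'm='m, OF g_diff lip g'_lip(2) _ M reg[OF elim(2)] B,
            unfolded m(1), OF _ p_hat p_N] elim(1) g'_lip(1)
        by (simp add: K_def f_def)
      moreover have "f t > 0" using False by (simp add: f_def)
      moreover have "norm ((1 / f t) *\<^sub>R p_hat t - (1 / f t) *\<^sub>R p_N t) = norm (p_hat t - p_N t) / f t"
        using \<open>f t > 0\<close> by (simp flip: scaleR_diff_right)
      ultimately show ?thesis
        by (simp add: power2_eq_square divide_le_eq mult.assoc)
    qed simp
  qed
  moreover have "(\<lambda>t. K * f t) \<longlonglongrightarrow> 0"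
    using tendsto_mult_left[OF f0, of K] by simp
  ultimately show ?thesis
    unfolding f_def[symmetric]
    by (elim Lim_null_comparison[rotated]) simp
qed

end
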